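(* Let $0<\rho\le\rho_+<1$. Consider the stationary half-space last passage percolation $L^{\rho_+}$ with parameter $\rho_+$ and the point-to-point half-space last passage percolation $L^{\mathrm{pp}}$ with diagonal parameter $\rho$, coupled as described in the context. Then for all points $p\preceq q$ of the half-space lattice $\{(i,j)\in\mathbb{Z}^2:i\ge j\ge0\}$, $$L^{\mathrm{pp}}(q)-L^{\mathrm{pp}}(p)\le L^{\rho_+}(q)-L^{\rho_+}(p).$$
   Context: Half-space last passage percolation: given weights $\omega_{i,j}$ on $\{(i,j)\in\mathbb{Z}^2: i\ge j\ge0\}$, put $L(b)=\max_{\pi}\sum_{(i,j)\in\pi\setminus\{(0,0)\}}\omega_{i,j}$, the maximum being over up-right lattice paths in the half-space from $(0,0)$ to $b$. $\exp(a)$ is the exponential law with rate $a$. Stationary model $L^{\rho}$, $\rho\in(0,1)$: weights $\omega^\rho_{0,0}=0$, $\omega^\rho_{i,i}\sim\exp(\rho)$ and $\omega^\rho_{i,0}\sim\exp(1-\rho)$ for $i\ge1$, $\omega^\rho_{i,j}\sim\exp(1)$ for $0<j<i$, all independent. Point-to-point model $L^{\mathrm{pp}}$ with diagonal parameter $\rho$: $\omega^{pp}_{0,0}=0$, $\omega^{pp}_{i,i}\sim\exp(\rho)$ and $\omega^{pp}_{i,0}=0$ for $i\ge1$, $\omega^{pp}_{i,j}\sim\exp(1)$ for $0<j<i$, all independent. Coupling: the two models have the same bulk weights, $\omega^{pp}_{i,j}=\omega^{\rho_+}_{i,j}$ for $0<j<i$, and (as $\rho_+\ge\rho$) ordered diagonal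 weights, $\omega^{pp}_{i,i}\ge\omega^{\rho_+}_{i,i}$ for all $i\ge1$. For $p=(p_1,p_2),q=(q_1,q_2)$, $p\preceq q$ means $p_1\le q_1$ and $p_2\ge q_2$. *)

theory Defs
  imports "HOL-Probability.Probability"
begin

definition half_space :: "(int \<times> int) set" where
  "half_space = {(i, j). i \<ge> j \<and> j \<ge> 0}"

definition up_right_step :: "int \<times> int \<Rightarrow> int \<times> int \<Rightarrow> bool" where
  "up_right_step x y \<longleftrightarrow>
     y = (fst x + 1, snd x) \<or> y = (fst x, snd x + 1)"

definition up_right_paths :: "int \<times> int \<Rightarrow> int \<times> int \<Rightarrow> (int \<times> int) list set" where
  "up_right_paths a b =
     {\<pi>. \<pi> \<noteq> [] \<and> hd \<pi> = a \<and> last \<pi> = b \<and> set \<pi> \<subseteq> half_space \<and> successively up_right_step \<pi>}"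

text \<open>The set under \<open>Max\<close> is finite, and it is nonempty exactly for \<open>b \<in> half_space\<close>;
  outside the half-space the value is unspecified.\<close>

definition lpp :: "(int \<times> int \<Rightarrow> real) \<Rightarrow> int \<times> int \<Rightarrow> real" where
  "lpp w b = Max ((\<lambda>\<pi>. \<Sum>x\<in>set \<pi> - {(0, 0)}. w x) ` up_right_paths (0, 0) b)"

definition southeast :: "int \<times> int \<Rightarrow> int \<times> int \<Rightarrow> bool" (infix "\<preceq>" 50) where
  "p \<preceq> q \<longleftrightarrow> fst p \<le> fst q \<and> snd p \<ge> snd q"

text \<open>Equalities and inequalities between weights are required almost surely only. The weights
  that are constantly zero may be included in the independent family, since constants are
  independent of everything.\<close>

definition stationary_weights ::
  "'a measure \<Rightarrow> real \<Rightarrow> (int \<times> int \<Rightarrow> 'a \<Rightarrow> real) \<Rightarrow> bool" where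
  "stationary_weights M \<rho> \<omega> \<longleftrightarrow>
     prob_space.indep_vars M (\<lambda>_. borel) \<omega> half_space \<and>
     (AE s in M. \<omega> (0, 0) s = 0) \<and>
     (\<forall>i\<ge>1. distributed M lborel (\<omega> (i, i)) (exponential_density \<rho>)) \<and>
     (\<forall>i\<ge>1. distributed M lborel (\<omega> (i, 0)) (exponential_density (1 - \<rho>))) \<and>
     (\<forall>i j. 0 < j \<and> j < i \<longrightarrow> distributed M lborel (\<omega> (i, j)) (exponential_density 1))"

definition point_to_point_weights ::
  "'a measure \<Rightarrow> real \<Rightarrow> (int \<times> int \<Rightarrow> 'a \<Rightarrow> real) \<Rightarrow> bool" where
  "point_to_point_weights M \<rho> \<omega> \<longleftrightarrow>
     prob_space.indep_vars M (\<lambda>_. borel) \<omega> half_space \<and>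
     (AE s in M. \<omega> (0, 0) s = 0) \<and>
     (\<forall>i\<ge>1. distributed M lborel (\<omega> (i, i)) (exponential_density \<rho>)) \<and>
     (\<forall>i\<ge>1. AE s in M. \<omega> (i, 0) s = 0) \<and>
     (\<forall>i j. 0 < j \<and> j < i \<longrightarrow> distributed M lborel (\<omega> (i, j)) (exponential_density 1))"

definition coupled_weights ::
  "'a measure \<Rightarrow> (int \<times> int \<Rightarrow> 'a \<Rightarrow> real) \<Rightarrow> (int \<times> int \<Rightarrow> 'a \<Rightarrow> real) \<Rightarrow> bool" where
  "coupled_weights M \<omega>\<^sub>p\<^sub>p \<omega>\<^sub>s\<^sub>t \<longleftrightarrow>
     (\<forall>i j. 0 < j \<and> j < i \<longrightarrow> (AE s in M. \<omega>\<^sub>p\<^sub>p (i, j) s = \<omega>\<^sub>s\<^sub>t (i, j) s)) \<and>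
     (\<forall>i\<ge>1. AE s in M. \<omega>\<^sub>p\<^sub>p (i, i) s \<ge> \<omega>\<^sub>s\<^sub>t (i, i) s)"

end

theory Submission imports Defs begin

text \<open>The last passage times satisfy a recursion in the last step of the path. It expresses
  the horizontal increment at a bulk point through the horizontal increment one row below and the
  vertical increment one column to the left, increasing in the former and decreasing in the
  latter; likewise for vertical increments with the roles exchanged. On the boundary, the
  increments are the weights themselves. Hence larger horizontal and smaller vertical increments
  propagate from the boundary to the whole half-space. The claim follows by moving
  from \<open>p\<close> to \<open>q\<close> first to the right and then down. All this holds pathwise; the distributions
  of the weights enter only through \<open>\<omega>\<^sub>s\<^sub>t (i, 0) \<ge> 0\<close>.\<close>

text \<open>Each step raises the coordinate sum by one. This keeps a new endpoint off the earlier
  path, so the sum over \<open>set\<close> gains its weight when the path is extended.\<close>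

lemma up_right_paths_level_le:
  assumes "\<pi> \<in> up_right_paths a b" "x \<in> set \<pi>"
  shows "fst x + snd x \<le> fst b + snd b"
proof -
  have "successively up_right_step \<pi> \<Longrightarrow> x \<in> set \<pi> \<Longrightarrow>
      fst x + snd x \<le> fst (last \<pi>) + snd (last \<pi>)" for \<pi>
  proof (induction \<pi> rule: rev_induct)
    case (snoc y \<pi>)
    show ?case
    proof (cases "x \<in> set \<pi>")
      case True
      hence "\<pi> \<noteq> []" by auto
      with snoc True show ?thesis
        by (fastforce simp: successively_append_iff up_right_step_def)
    qed (use snoc in auto)
  qed simp
  with assms show ?thesis by (auto simp: up_right_paths_def)
qed

lemma up_right_paths_outside: "b \<notin> half_space \<Longrightarrow> up_right_paths a b = {}"
  unfolding up_right_paths_def using last_in_set by blast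

text \<open>The predecessors need not lie in the half-space: one outside contributes the empty set,
  so a single formula covers bottom, diagonal and bulk.\<close>

lemma up_right_paths_snoc:
  assumes "a \<noteq> (i, j)" "(i, j) \<in> half_space"
  shows "up_right_paths a (i, j) =
    (\<lambda>\<pi>. \<pi> @ [(i, j)]) ` (up_right_paths a (i - 1, j) \<union> up_right_paths a (i, j - 1))"
    (is "?L = ?R")
proof
  show "?L \<subseteq> ?R"
  proof
    fix \<pi> assume \<pi>: "\<pi> \<in> ?L"
    then obtain \<pi>' where \<pi>': "\<pi> = \<pi>' @ [(i, j)]"
      unfolding up_right_paths_def by (cases \<pi> rule: rev_cases) auto
    with \<pi> assms have ne: "\<pi>' \<noteq> []"
      by (auto simp: up_right_paths_def)
    with \<pi> have "up_right_step (last \<pi>') (i, j)"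
      by (auto simp: up_right_paths_def \<pi>' successively_append_iff)
    hence "last \<pi>' = (i - 1, j) \<or> last \<pi>' = (i, j - 1)"
      by (cases "last \<pi>'") (auto simp: up_right_step_def)
    with \<pi> ne have "\<pi>' \<in> up_right_paths a (i - 1, j) \<union> up_right_paths a (i, j - 1)"
      by (auto simp: up_right_paths_def \<pi>' successively_append_iff)
    with \<pi>' show "\<pi> \<in> ?R" by blast
  qed
  show "?R \<subseteq> ?L"
    using assms by (auto simp: up_right_paths_def successively_append_iff up_right_step_def)
qed

lemma up_right_paths_origin: "up_right_paths (0, 0) (0, 0) = {[(0, 0)]}"
proof -
  have "\<pi> = [(0, 0)]" if \<pi>: "\<pi> \<in> up_right_paths (0, 0) (0, 0)" for \<pi>
  proof -
    obtain \<pi>' where \<pi>': "\<pi> = \<pi>' @ [(0, 0)]"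
      using \<pi> unfolding up_right_paths_def by (cases \<pi> rule: rev_cases) auto
    have "\<pi>' = []"
    proof (rule ccontr)
      assume ne: "\<pi>' \<noteq> []"
      with \<pi> have "up_right_step (last \<pi>') (0, 0)" "last \<pi>' \<in> half_space"
        by (auto simp: up_right_paths_def \<pi>' successively_append_iff)
      thus False
        by (cases "last \<pi>'") (auto simp: up_right_step_def half_space_def)
    qed
    with \<pi>' show ?thesis by simp
  qed
  thus ?thesis by (auto simp: up_right_paths_def half_space_def)
qed

lemma up_right_paths_finite_nonempty:
  assumes "b \<in> half_space"
  shows "finite (up_right_paths (0, 0) b) \<and> up_right_paths (0, 0) b \<noteq> {}"
  using assms
proof (induction "nat (fst b + snd b)" arbitrary: b rule: less_induct)
  case less
  obtain i j where b: "b = (i, j)" by force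
  have ij: "j \<le> i" "0 \<le> j" using less.prems by (auto simp: b half_space_def)
  show ?case
  proof (cases "i = 0")
    case True
    with ij show ?thesis by (simp add: b up_right_paths_origin)
  next
    case False
    have fin: "finite (up_right_paths (0, 0) c)"
      if "c = (i - 1, j) \<or> c = (i, j - 1)" for c
    proof (cases "c \<in> half_space")
      case True
      with less.hyps[of c] that ij False show ?thesis by (auto simp: b)
    qed (simp add: up_right_paths_outside)
    \<comment> \<open>The left neighbour qualifies if \<open>j < i\<close>, the lower one if
      \<open>j = i\<close>, since then \<open>j > 0\<close>.\<close>
    have "(i - 1, j) \<in> half_space \<or> (i, j - 1) \<in> half_space"
      using ij False by (auto simp: half_space_def)
    hence "up_right_paths (0, 0) (i - 1, j) \<union> up_right_paths (0, 0) (i, j - 1) \<noteq> {}"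
      using less.hyps[of "(i - 1, j)"] less.hyps[of "(i, j - 1)"] ij False by (auto simp: b)
    with fin show ?thesis
      using less.prems False by (auto simp: b up_right_paths_snoc)
  qed
qed

text \<open>The maximum is kept over a union of path sets: on the boundary one of them is empty, and
  its \<open>lpp\<close> value is unspecified.\<close>

lemma lpp_last_step:
  assumes "(i, j) \<in> half_space" "0 < i"
  shows "lpp w (i, j) = Max ((\<lambda>\<pi>. \<Sum>x\<in>set \<pi> - {(0, 0)}. w x) `
    (up_right_paths (0, 0) (i - 1, j) \<union> up_right_paths (0, 0) (i, j - 1))) + w (i, j)"
proof -
  let ?P = "up_right_paths (0, 0) (i - 1, j) \<union> up_right_paths (0, 0) (i, j - 1)"
  let ?S = "\<lambda>\<pi>. \<Sum>x\<in>set \<pi> - {(0, 0)}. w x"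
  have paths: "up_right_paths (0, 0) (i, j) = (\<lambda>\<pi>. \<pi> @ [(i, j)]) ` ?P"
    using assms by (intro up_right_paths_snoc) auto
  \<comment> \<open>Appending the endpoint is injective, so both facts pull back from the paths to
    \<open>(i, j)\<close> without deciding which predecessor is admissible.\<close>
  have fin: "finite ?P" and ne: "?P \<noteq> {}"
    using up_right_paths_finite_nonempty[OF assms(1)] unfolding paths
    by (auto dest: finite_imageD simp: inj_on_def)
  have "?S (\<pi> @ [(i, j)]) = ?S \<pi> + w (i, j)" if "\<pi> \<in> ?P" for \<pi>
  proof -
    have "(i, j) \<notin> set \<pi>"
      using that by (auto dest!: up_right_paths_level_le)
    moreover have "set (\<pi> @ [(i, j)]) - {(0, 0)} = insert (i, j) (set \<pi> - {(0, 0)})"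
      using assms by auto
    ultimately show ?thesis by simp
  qed
  hence "?S ` up_right_paths (0, 0) (i, j) = (\<lambda>\<pi>. ?S \<pi> + w (i, j)) ` ?P"
    unfolding paths image_image by (intro image_cong) auto
  thus ?thesis
    using Max_add_commute[OF fin ne, of ?S "w (i, j)"] by (simp only: lpp_def)
qed

lemma lpp_bottom:
  assumes "0 < i"
  shows "lpp w (i, 0) = lpp w (i - 1, 0) + w (i, 0)"
proof -
  have "(i, 0) \<in> half_space" "(i, - 1) \<notin> half_space"
    using assms by (auto simp: half_space_def)
  thus ?thesis
    using lpp_last_step[of i 0 w] assms by (simp add: up_right_paths_outside lpp_def)
qed

lemma lpp_diagonal:
  assumes "0 < i"
  shows "lpp w (i, i) = lpp w (i, i - 1) + w (i, i)"
proof -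
  have "(i, i) \<in> half_space" "(i - 1, i) \<notin> half_space"
    using assms by (auto simp: half_space_def)
  thus ?thesis
    using lpp_last_step[of i i w] assms by (simp add: up_right_paths_outside lpp_def)
qed

lemma lpp_bulk:
  assumes "0 < j" "j < i"
  shows "lpp w (i, j) = max (lpp w (i - 1, j)) (lpp w (i, j - 1)) + w (i, j)"
proof -
  have "(i, j) \<in> half_space" "(i - 1, j) \<in> half_space" "(i, j - 1) \<in> half_space"
    using assms by (auto simp: half_space_def)
  moreover from this(2,3) have
    "Max (f ` (up_right_paths (0, 0) (i - 1, j) \<union> up_right_paths (0, 0) (i, j - 1))) =
      max (Max (f ` up_right_paths (0, 0) (i - 1, j)))
        (Max (f ` up_right_paths (0, 0) (i, j - 1)))" for f :: "_ \<Rightarrow> real"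
    unfolding image_Un by (intro Max_Un) (auto dest: up_right_paths_finite_nonempty)
  ultimately show ?thesis
    using lpp_last_step[of i j w] assms by (simp add: lpp_def)
qed

context
  fixes v w :: "int \<times> int \<Rightarrow> real"
  assumes bottom: "\<And>i. 0 < i \<Longrightarrow> v (i, 0) \<le> w (i, 0)"
    and diagonal: "\<And>i. 0 < i \<Longrightarrow> w (i, i) \<le> v (i, i)"
    and bulk: "\<And>i j. 0 < j \<Longrightarrow> j < i \<Longrightarrow> v (i, j) = w (i, j)"
begin

text \<open>Here \<open>v\<close> plays the point-to-point weights at a fixed sample and
  \<open>w\<close> the stationary ones. Both inequalities go through one induction on
  \<open>i + j\<close>, as each bulk increment depends on increments of both kinds.\<close>

lemma lpp_increment_mono:
  "0 \<le> j \<Longrightarrow> j < i \<Longrightarrow>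
     lpp v (i, j) - lpp v (i - 1, j) \<le> lpp w (i, j) - lpp w (i - 1, j)"
  "0 < j \<Longrightarrow> j \<le> i \<Longrightarrow>
     lpp w (i, j) - lpp w (i, j - 1) \<le> lpp v (i, j) - lpp v (i, j - 1)"
proof (induction "nat (i + j)" arbitrary: i j rule: less_induct)
  case less
  have in_bulk: "lpp v (i, j) - lpp v (i - 1, j) \<le> lpp w (i, j) - lpp w (i - 1, j) \<and>
      lpp w (i, j) - lpp w (i, j - 1) \<le> lpp v (i, j) - lpp v (i, j - 1)"
    if ij: "0 < j" "j < i"
  proof -
    have "lpp v (i, j - 1) - lpp v (i - 1, j - 1) \<le> lpp w (i, j - 1) - lpp w (i - 1, j - 1)"
      using ij by (intro less.hyps(1)) auto
    moreover have
      "lpp w (i - 1, j) - lpp w (i - 1, j - 1) \<le> lpp v (i - 1, j) - lpp v (i - 1, j - 1)"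
      using ij by (intro less.hyps(2)) auto
    \<comment> \<open>With \<open>H\<close> the horizontal increment at \<open>(i, j - 1)\<close>
      and \<open>V\<close> the vertical one at \<open>(i - 1, j)\<close>, the new increments are
      \<open>max 0 (H - V)\<close> and \<open>max 0 (V - H)\<close>, each plus the common bulk
      weight.\<close>
    ultimately show ?thesis
      using lpp_bulk[OF ij, of v] lpp_bulk[OF ij, of w] bulk[OF ij] by linarith
  qed
  {
    case 1
    thus ?case
      using in_bulk lpp_bottom[of i] bottom[of i] by (cases "j = 0") auto
  next
    case 2
    thus ?case
      using in_bulk lpp_diagonal[of i] diagonal[of i] by (cases "j = i") auto
  }
qed

lemma lpp_diff_mono_right:
  assumes "i \<le> i'" "0 \<le> j" "j \<le> i"
  shows "lpp v (i', j) - lpp v (i, j) \<le> lpp w (i', j) - lpp w (i, j)"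
  using assms(1)
proof (induction i' rule: int_ge_induct)
  case (step k)
  with lpp_increment_mono(1)[of j "k + 1"] assms show ?case by simp
qed simp

text \<open>Descending negates vertical increments, so their reversed order yields the same
  direction as for moves to the right.\<close>

lemma lpp_diff_mono_down:
  assumes "j \<le> j'" "0 \<le> j" "j' \<le> i"
  shows "lpp v (i, j) - lpp v (i, j') \<le> lpp w (i, j) - lpp w (i, j')"
  using assms(1,3)
proof (induction j' rule: int_ge_induct)
  case (step k)
  with lpp_increment_mono(2)[of "k + 1" i] assms(2) show ?case by simp
qed simp

lemma lpp_diff_mono_southeast:
  assumes "p \<in> half_space" "q \<in> half_space" "p \<preceq> q"
  shows "lpp v q - lpp v p \<le> lpp w q - lpp w p"
proof -
  obtain i j i' j' where pq: "p = (i, j)" "q = (i', j')" by (metis surj_pair)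
  \<comment> \<open>The corner \<open>(i', j)\<close> stays in the half-space because
    \<open>j \<le> i \<le> i'\<close>.\<close>
  with assms have "lpp v (i', j) - lpp v (i, j) \<le> lpp w (i', j) - lpp w (i, j)"
    "lpp v (i', j') - lpp v (i', j) \<le> lpp w (i', j') - lpp w (i', j)"
    by (auto intro!: lpp_diff_mono_right lpp_diff_mono_down simp: half_space_def southeast_def)
  with pq show ?thesis by simp
qed

end

text \<open>The density vanishes on the negative half-line.\<close>

lemma distributed_exponential_AE_nonneg:
  assumes "distributed M lborel X (exponential_density l)"
  shows "AE s in M. 0 \<le> X s"
proof -
  have "AE x in distr M lborel X. 0 \<le> x"
    unfolding distributed_distr_eq_density[OF assms]
    using distributed_borel_measurable[OF assms]
    by (subst AE_density) (auto simp: erlang_density_def)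
  thus ?thesis
    using AE_distrD[OF distributed_measurable[OF assms]] by blast
qed

theorem corollary3p4:
  fixes M :: "'a measure"
    and \<rho> \<rho>\<^sub>p\<^sub>l\<^sub>u\<^sub>s :: real
    and \<omega>\<^sub>p\<^sub>p \<omega>\<^sub>s\<^sub>t :: "int \<times> int \<Rightarrow> 'a \<Rightarrow> real"
  assumes "prob_space M"
    and "0 < \<rho>" and "\<rho> \<le> \<rho>\<^sub>p\<^sub>l\<^sub>u\<^sub>s" and "\<rho>\<^sub>p\<^sub>l\<^sub>u\<^sub>s < 1"
    and "stationary_weights M \<rho>\<^sub>p\<^sub>l\<^sub>u\<^sub>s \<omega>\<^sub>s\<^sub>t"
    and "point_to_point_weights M \<rho> \<omega>\<^sub>p\<^sub>p"
    and "coupled_weights M \<omega>\<^sub>p\<^sub>p \<omega>\<^sub>s\<^sub>t"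
  shows "AE s in M. \<forall>p\<in>half_space. \<forall>q\<in>half_space. p \<preceq> q \<longrightarrow>
           lpp (\<lambda>x. \<omega>\<^sub>p\<^sub>p x s) q - lpp (\<lambda>x. \<omega>\<^sub>p\<^sub>p x s) p
             \<le> lpp (\<lambda>x. \<omega>\<^sub>s\<^sub>t x s) q - lpp (\<lambda>x. \<omega>\<^sub>s\<^sub>t x s) p"
proof -
  note st = assms(5)[unfolded stationary_weights_def]
  note pp = assms(6)[unfolded point_to_point_weights_def]
  note coupling = assms(7)[unfolded coupled_weights_def]
  \<comment> \<open>The index set is countable, so one null set serves all sites and hence all pairs
    \<open>p\<close>, \<open>q\<close> at once.\<close>
  have "AE s in M. \<forall>i. 0 < i \<longrightarrow> \<omega>\<^sub>p\<^sub>p (i, 0) s \<le> \<omega>\<^sub>s\<^sub>t (i, 0) s"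
    unfolding AE_all_countable
  proof
    fix i :: int
    show "AE s in M. 0 < i \<longrightarrow> \<omega>\<^sub>p\<^sub>p (i, 0) s \<le> \<omega>\<^sub>s\<^sub>t (i, 0) s"
    proof (cases "0 < i")
      case True
      hence "AE s in M. 0 \<le> \<omega>\<^sub>s\<^sub>t (i, 0) s"
        using st by (intro distributed_exponential_AE_nonneg[where l = "1 - \<rho>\<^sub>p\<^sub>l\<^sub>u\<^sub>s"]) auto
      moreover have "AE s in M. \<omega>\<^sub>p\<^sub>p (i, 0) s = 0"
        using pp True by auto
      ultimately show ?thesis by eventually_elim simp
    qed simp
  qed
  moreover have "AE s in M. \<forall>i. 0 < i \<longrightarrow> \<omega>\<^sub>s\<^sub>t (i, i) s \<le> \<omega>\<^sub>p\<^sub>p (i, i) s"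
    using coupling by (auto simp: AE_all_countable)
  moreover have "AE s in M. \<forall>i j. 0 < j \<longrightarrow> j < i \<longrightarrow> \<omega>\<^sub>p\<^sub>p (i, j) s = \<omega>\<^sub>s\<^sub>t (i, j) s"
    using coupling by (auto simp: AE_all_countable)
  ultimately show ?thesis
    by eventually_elim (blast intro: lpp_diff_mono_southeast)
qed

end
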